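(* Let $\{(F_i,U_i)\}_{i=1}^n\subset L^2(D_{\mathcal X})\times L^2(D_{\mathcal Y})$ be functional data, let $\rho,\lambda>0$, and for $\beta\in\mathcal B$, $G\in\mathcal G$ define $$\widehat R_{\rho,\lambda}(\beta,G)=\frac1n\sum_{i=1}^n\Big\|U_i-\beta-\int_{D_{\mathcal X}}G(x,\cdot)F_i(x)\,dx\Big\|_{L^2(D_{\mathcal Y})}^2+\rho\|\beta\|_{\mathcal B}^2+\lambda\|G\|_{\mathcal G}^2 .$$ Then for any minimizer $(\widehat\beta_{n,\rho,\lambda},\widehat G_{n,\rho,\lambda})$ of $\widehat R_{\rho,\lambda}$ over $\mathcal B\times\mathcal G$, the function $\widehat G_{n,\rho,\lambda}$ must have the form $$\widehat G_{n,\rho,\lambda}(x,y)=\sum_{i=1}^n\int_{D_{\mathcal X}}\int_{D_{\mathcal Y}}K(x,y,\xi,\eta)F_i(\xi)c_i(\eta)\,d\xi\,d\eta$$ for some coefficient functions $c_i\in L^2(D_{\mathcal Y})$, $i=1,\dots,n$.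
   Context: $D_{\mathcal X}\subset\mathbb R^{d_{\mathcal X}}$ and $D_{\mathcal Y}\subset\mathbb R^{d_{\mathcal Y}}$ are compact domains. $\mathcal G$ is a (real) reproducing kernel Hilbert space (RKHS) of functions on $D_{\mathcal X}\times D_{\mathcal Y}$ with reproducing kernel $K:(D_{\mathcal X}\times D_{\mathcal Y})\times(D_{\mathcal X}\times D_{\mathcal Y})\to\mathbb R$, and $\mathcal B$ is an RKHS of functions on $D_{\mathcal Y}$ with reproducing kernel $Q:D_{\mathcal Y}\times D_{\mathcal Y}\to\mathbb R$. Both kernels are continuous, square integrable, symmetric and strictly positive definite. $\|\cdot\|_{\mathcal G}$ and $\|\cdot\|_{\mathcal B}$ are the RKHS norms. *)

theory Defs
  imports "HOL-Analysis.Analysis"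
begin

section \<open>Square-integrable functions on a subset of a Euclidean space\<close>

text \<open>
  Elements of \<open>L\<^sup>2(D)\<close> are given by representatives on the whole type; only their values on
  \<open>D\<close> matter, since \<^term>\<open>lebesgue_on D\<close> has \<open>D\<close> as its space.
\<close>

definition L2 :: "'a::euclidean_space set \<Rightarrow> ('a \<Rightarrow> real) set" where
  "L2 D = {f \<in> borel_measurable (lebesgue_on D). integrable (lebesgue_on D) (\<lambda>x. (f x)\<^sup>2)}"

definition L2_norm :: "'a::euclidean_space set \<Rightarrow> ('a \<Rightarrow> real) \<Rightarrow> real" where
  "L2_norm D f = sqrt (LINT x|lebesgue_on D. (f x)\<^sup>2)"


section \<open>Real Hilbert spaces of functions\<close>

text \<open>
  A real-valued function on \<open>D\<close> is represented by the total function that extends it by \<open>0\<close>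
  (assumption \<open>vanishes\<close>), so that equality in \<open>H\<close> is equality of functions on \<open>D\<close> and the
  vector space operations are the pointwise ones. Nothing is assumed about \<open>ip\<close> outside \<open>H\<close>.
\<close>

definition ip_norm :: "(('z \<Rightarrow> real) \<Rightarrow> ('z \<Rightarrow> real) \<Rightarrow> real) \<Rightarrow> ('z \<Rightarrow> real) \<Rightarrow> real" where
  "ip_norm ip f = sqrt (ip f f)"

locale function_hilbert_space =
  fixes D :: "'z set"
    and H :: "('z \<Rightarrow> real) set"
    and ip :: "('z \<Rightarrow> real) \<Rightarrow> ('z \<Rightarrow> real) \<Rightarrow> real"
  assumes vanishes: "\<And>f z. f \<in> H \<Longrightarrow> z \<notin> D \<Longrightarrow> f z = 0"
    and zero_mem: "(\<lambda>z. 0) \<in> H"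
    and add_mem: "\<And>f g. f \<in> H \<Longrightarrow> g \<in> H \<Longrightarrow> (\<lambda>z. f z + g z) \<in> H"
    and scale_mem: "\<And>a f. f \<in> H \<Longrightarrow> (\<lambda>z. a * f z) \<in> H"
    and ip_commute: "\<And>f g. f \<in> H \<Longrightarrow> g \<in> H \<Longrightarrow> ip f g = ip g f"
    and ip_add: "\<And>f g h. f \<in> H \<Longrightarrow> g \<in> H \<Longrightarrow> h \<in> H \<Longrightarrow>
      ip (\<lambda>z. f z + g z) h = ip f h + ip g h"
    and ip_scale: "\<And>a f g. f \<in> H \<Longrightarrow> g \<in> H \<Longrightarrow> ip (\<lambda>z. a * f z) g = a * ip f g"
    and ip_nonneg: "\<And>f. f \<in> H \<Longrightarrow> 0 \<le> ip f f"
    and ip_definite: "\<And>f. f \<in> H \<Longrightarrow> ip f f = 0 \<Longrightarrow> f = (\<lambda>z. 0)"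
    and complete: "\<And>s :: nat \<Rightarrow> 'z \<Rightarrow> real.
      (\<And>k. s k \<in> H) \<Longrightarrow>
      (\<forall>e>0. \<exists>N. \<forall>m\<ge>N. \<forall>k\<ge>N. ip_norm ip (\<lambda>z. s m z - s k z) < e) \<Longrightarrow>
      \<exists>f\<in>H. (\<lambda>k. ip_norm ip (\<lambda>z. s k z - f z)) \<longlonglongrightarrow> 0"


section \<open>Kernels and reproducing kernel Hilbert spaces\<close>

text \<open>
  Kernels are likewise total functions of which only the values on \<open>D \<times> D\<close> matter; the section of
  \<open>K\<close> at \<open>z\<close> is cut off outside \<open>D\<close> to match the representation above.
\<close>

definition kernel_section :: "'z set \<Rightarrow> ('z \<Rightarrow> 'z \<Rightarrow> real) \<Rightarrow> 'z \<Rightarrow> 'z \<Rightarrow> real" where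
  "kernel_section D K z = (\<lambda>w. if w \<in> D then K z w else 0)"

locale rkhs = function_hilbert_space D H ip
  for D :: "'z set" and H :: "('z \<Rightarrow> real) set" and ip +
  fixes K :: "'z \<Rightarrow> 'z \<Rightarrow> real"
  assumes section_mem: "\<And>z. z \<in> D \<Longrightarrow> kernel_section D K z \<in> H"
    and reproducing: "\<And>f z. f \<in> H \<Longrightarrow> z \<in> D \<Longrightarrow> f z = ip f (kernel_section D K z)"

definition continuous_kernel :: "'z::topological_space set \<Rightarrow> ('z \<Rightarrow> 'z \<Rightarrow> real) \<Rightarrow> bool" where
  "continuous_kernel D K \<longleftrightarrow> continuous_on (D \<times> D) (\<lambda>(z, w). K z w)"

definition square_integrable_kernel ::
    "'z::euclidean_space set \<Rightarrow> ('z \<Rightarrow> 'z \<Rightarrow> real) \<Rightarrow> bool" where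
  "square_integrable_kernel D K \<longleftrightarrow> (\<lambda>(z, w). K z w) \<in> L2 (D \<times> D)"

definition symmetric_kernel :: "'z set \<Rightarrow> ('z \<Rightarrow> 'z \<Rightarrow> real) \<Rightarrow> bool" where
  "symmetric_kernel D K \<longleftrightarrow> (\<forall>z\<in>D. \<forall>w\<in>D. K z w = K w z)"

definition strictly_positive_definite_kernel :: "'z set \<Rightarrow> ('z \<Rightarrow> 'z \<Rightarrow> real) \<Rightarrow> bool" where
  "strictly_positive_definite_kernel D K \<longleftrightarrow>
     (\<forall>S a. finite S \<and> S \<subseteq> D \<and> (\<exists>z\<in>S. a z \<noteq> 0) \<longrightarrow>
        0 < (\<Sum>z\<in>S. \<Sum>w\<in>S. a z * a w * K z w))"


section \<open>The regularized empirical risk\<close>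

definition reg_emp_risk ::
    "'a::euclidean_space set \<Rightarrow> 'b::euclidean_space set \<Rightarrow>
     (('b \<Rightarrow> real) \<Rightarrow> ('b \<Rightarrow> real) \<Rightarrow> real) \<Rightarrow>
     (('a \<times> 'b \<Rightarrow> real) \<Rightarrow> ('a \<times> 'b \<Rightarrow> real) \<Rightarrow> real) \<Rightarrow>
     nat \<Rightarrow> (nat \<Rightarrow> 'a \<Rightarrow> real) \<Rightarrow> (nat \<Rightarrow> 'b \<Rightarrow> real) \<Rightarrow> real \<Rightarrow> real \<Rightarrow>
     ('b \<Rightarrow> real) \<Rightarrow> ('a \<times> 'b \<Rightarrow> real) \<Rightarrow> real" where
  "reg_emp_risk DX DY ipB ipG n F U \<rho> \<mu> \<beta> G =
     1 / real n * (\<Sum>i=1..n.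
       (L2_norm DY (\<lambda>y. U i y - \<beta> y - (LINT x|lebesgue_on DX. G (x, y) * F i x)))\<^sup>2)
     + \<rho> * (ip_norm ipB \<beta>)\<^sup>2 + \<mu> * (ip_norm ipG G)\<^sup>2"

end

theory Submission
  imports Defs
begin

text \<open>
  The representation is the Euler--Lagrange equation of the risk in the variable \<open>G\<close>, read off
  pointwise by means of the reproducing property. Write \<open>T\<^sub>i G = \<integral> G(x, \<cdot>) F\<^sub>i(x) dx\<close>
  for the linear operators in the risk and \<open>r\<^sub>i = U\<^sub>i - \<beta>hat - T\<^sub>i Ghat\<close> for the residuals
  at the minimizer. Along any line \<open>Ghat + t G\<close> the risk is a quadratic polynomial in \<open>t\<close> that is
  minimal at \<open>t = 0\<close>, so its linear coefficient vanishes: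
  \<open>\<mu> \<langle>Ghat, G\<rangle> = 1/n \<Sum>\<^sub>i \<langle>r\<^sub>i, T\<^sub>i G\<rangle>\<close>, with the inner product of the function space
  on the left and that of \<open>L\<^sup>2\<close> on the right.

  Now let \<open>G\<close> be the section of the kernel at \<open>(x, y)\<close>. The left-hand side is \<open>\<mu> Ghat(x, y)\<close>, and
  the right-hand side is an iterated integral of \<open>K(x, y, \<xi>, \<eta>) F\<^sub>i(\<xi>) r\<^sub>i(\<eta>)\<close>. Exchanging
  the order of integration gives the claim with \<open>c\<^sub>i = r\<^sub>i / (\<mu> n)\<close>.

  What remains is analytic: the integrals must exist. A continuous kernel makes every member of its
  Hilbert space continuous (\<open>rkhs_member_continuous_on\<close>), hence square integrable on a compact
  domain, and \<open>T\<^sub>i\<close> maps continuous functions to continuous functions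
  (\<open>continuous_on_integral_operator\<close>); so the residuals lie in \<open>L\<^sup>2\<close>. Boundedness of a continuous
  function on the compact product domain supplies the integrability that the exchange of integrals
  needs (\<open>integral_operator_Fubini\<close>).
\<close>

section \<open>Square-integrable functions on compact sets\<close>

lemma L2_measurable: "f \<in> L2 D \<Longrightarrow> f \<in> borel_measurable (lebesgue_on D)"
  and L2_integrable_square: "f \<in> L2 D \<Longrightarrow> integrable (lebesgue_on D) (\<lambda>x. (f x)\<^sup>2)"
  by (auto simp: L2_def)

lemma L2_integrable_mult:
  assumes "f \<in> L2 D" "g \<in> L2 D"
  shows "integrable (lebesgue_on D) (\<lambda>x. f x * g x)"
proof (rule Bochner_Integration.integrable_bound)
  show "integrable (lebesgue_on D) (\<lambda>x. (f x)\<^sup>2 + (g x)\<^sup>2)"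
    using assms by (intro Bochner_Integration.integrable_add L2_integrable_square)
  show "(\<lambda>x. f x * g x) \<in> borel_measurable (lebesgue_on D)"
    using assms by (intro borel_measurable_times L2_measurable)
  have "\<bar>a * b\<bar> \<le> a\<^sup>2 + b\<^sup>2" for a b :: real
  proof -
    have "0 \<le> (\<bar>a\<bar> - \<bar>b\<bar>)\<^sup>2 + a\<^sup>2 + b\<^sup>2"
      by simp
    then show ?thesis
      by (simp add: power2_diff abs_mult)
  qed
  then show "AE x in lebesgue_on D. norm (f x * g x) \<le> norm ((f x)\<^sup>2 + (g x)\<^sup>2)"
    by simp
qed

lemma L2_scale: "f \<in> L2 D \<Longrightarrow> (\<lambda>x. a * f x) \<in> L2 D"
  by (auto simp: L2_def power_mult_distrib)

lemma L2_diff: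
  assumes "f \<in> L2 D" "g \<in> L2 D"
  shows "(\<lambda>x. f x - g x) \<in> L2 D"
proof -
  have "integrable (lebesgue_on D) (\<lambda>x. (f x)\<^sup>2 + (g x)\<^sup>2 - 2 * (f x * g x))"
    using assms by (intro Bochner_Integration.integrable_add Bochner_Integration.integrable_diff
        integrable_mult_right L2_integrable_square L2_integrable_mult)
  moreover have "(\<lambda>x. (f x)\<^sup>2 + (g x)\<^sup>2 - 2 * (f x * g x)) = (\<lambda>x. (f x - g x)\<^sup>2)"
    by (auto simp: power2_diff)
  ultimately show ?thesis
    using L2_measurable[OF assms(1)] L2_measurable[OF assms(2)] by (simp add: L2_def)
qed

lemma L2_norm_square: "(L2_norm D f)\<^sup>2 = (LINT x|lebesgue_on D. (f x)\<^sup>2)"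
  by (simp add: L2_norm_def)

text \<open>The data term of the risk is evaluated along a line by this expansion.\<close>

lemma L2_norm_square_diff_scale:
  assumes f: "f \<in> L2 D" and g: "g \<in> L2 D"
  shows "(L2_norm D (\<lambda>x. f x - t * g x))\<^sup>2 =
    (L2_norm D f)\<^sup>2 - 2 * t * (LINT x|lebesgue_on D. f x * g x) + t\<^sup>2 * (L2_norm D g)\<^sup>2"
proof -
  have "(\<lambda>x. (f x - t * g x)\<^sup>2) = (\<lambda>x. (f x)\<^sup>2 - 2 * t * (f x * g x) + t\<^sup>2 * (g x)\<^sup>2)"
    by (auto simp: power2_diff power_mult_distrib)
  then show ?thesis
    using L2_integrable_square[OF f] L2_integrable_square[OF g] L2_integrable_mult[OF f g]
    by (simp add: L2_norm_square)
qed

lemma continuous_on_compact_bounded_by: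
  fixes f :: "'a::topological_space \<Rightarrow> real"
  assumes "compact D" "continuous_on D f"
  obtains B where "0 \<le> B" "\<And>x. x \<in> D \<Longrightarrow> \<bar>f x\<bar> \<le> B"
proof -
  have "bounded (f ` D)"
    using assms by (intro compact_imp_bounded compact_continuous_image)
  then obtain B where "\<forall>x\<in>D. \<bar>f x\<bar> \<le> B"
    by (auto simp: bounded_iff)
  then show ?thesis
    by (intro that[of "max B 0"]) force+
qed

lemma continuous_on_compact_L2:
  fixes f :: "'a::euclidean_space \<Rightarrow> real"
  assumes D: "compact D" and f: "continuous_on D f"
  shows "f \<in> L2 D"
proof -
  interpret finite_measure "lebesgue_on D"
    using D by (intro finite_measure_lebesgue_on lmeasurable_compact)
  have meas: "f \<in> borel_measurable (lebesgue_on D)"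
    using D f by (intro continuous_imp_measurable_on_sets_lebesgue)
      (auto simp: lmeasurable_compact fmeasurableD)
  obtain B where "0 \<le> B" "\<And>x. x \<in> D \<Longrightarrow> \<bar>f x\<bar> \<le> B"
    using continuous_on_compact_bounded_by[OF D f] by blast
  then have "AE x in lebesgue_on D. norm ((f x)\<^sup>2) \<le> B\<^sup>2"
    by (intro AE_I2) (auto intro!: abs_le_square_iff[THEN iffD1])
  with meas show ?thesis
    by (auto simp: L2_def intro!: integrable_const_bound)
qed

lemma L2_integrable:
  assumes "compact D" "f \<in> L2 D"
  shows "integrable (lebesgue_on D) f"
  using L2_integrable_mult[OF assms(2) continuous_on_compact_L2[OF assms(1) continuous_on_const[of _ 1]]]
  by simp

section \<open>Integral operators with continuous kernels\<close>

lemma integrable_continuous_section_mult: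
  fixes G :: "'a::euclidean_space \<times> 'b::topological_space \<Rightarrow> real"
  assumes X: "compact X" and G: "continuous_on (X \<times> Y) G" and F: "F \<in> L2 X" and y: "y \<in> Y"
  shows "integrable (lebesgue_on X) (\<lambda>x. G (x, y) * F x)"
proof -
  have "continuous_on X (\<lambda>x. G (x, y))"
    using y by (intro continuous_on_compose2[OF G] continuous_intros) auto
  then show ?thesis
    using L2_integrable_mult[OF continuous_on_compact_L2[OF X] F] by blast
qed

text \<open>
  The integrands converge pointwise along any sequence of parameters, and they are dominated by
  a multiple of \<open>\<bar>F\<bar>\<close> because \<open>G\<close> is bounded.
\<close>

lemma continuous_on_integral_operator:
  fixes G :: "'a::euclidean_space \<times> 'b::euclidean_space \<Rightarrow> real"
  assumes X: "compact X" and Y: "compact Y" and G: "continuous_on (X \<times> Y) G" and F: "F \<in> L2 X"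
  shows "continuous_on Y (\<lambda>y. LINT x|lebesgue_on X. G (x, y) * F x)"
proof -
  obtain B where B: "\<And>p. p \<in> X \<times> Y \<Longrightarrow> \<bar>G p\<bar> \<le> B"
    using continuous_on_compact_bounded_by[OF compact_Times[OF X Y] G] by blast
  have "(\<lambda>k. LINT x|lebesgue_on X. G (x, s k) * F x)
          \<longlonglongrightarrow> (LINT x|lebesgue_on X. G (x, y) * F x)"
    if s: "\<forall>k. s k \<in> Y" "s \<longlonglongrightarrow> y" and y: "y \<in> Y" for s y
  proof (rule integral_dominated_convergence)
    show "integrable (lebesgue_on X) (\<lambda>x. B * \<bar>F x\<bar>)"
      using L2_integrable[OF X F] by (intro integrable_mult_right integrable_abs)
    show "(\<lambda>x. G (x, y) * F x) \<in> borel_measurable (lebesgue_on X)"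
      using integrable_continuous_section_mult[OF X G F y] by (rule borel_measurable_integrable)
    show "(\<lambda>x. G (x, s k) * F x) \<in> borel_measurable (lebesgue_on X)" for k
      using integrable_continuous_section_mult[OF X G F, of "s k"] s
      by (intro borel_measurable_integrable) auto
    show "AE x in lebesgue_on X. norm (G (x, s k) * F x) \<le> B * \<bar>F x\<bar>" for k
      using B s by (intro AE_I2) (auto simp: abs_mult intro!: mult_right_mono)
    show "AE x in lebesgue_on X. (\<lambda>k. G (x, s k) * F x) \<longlonglongrightarrow> G (x, y) * F x"
    proof (intro AE_I2 tendsto_mult tendsto_const)
      fix x assume "x \<in> space (lebesgue_on X)"
      then have x: "x \<in> X" by simp
      show "(\<lambda>k. G (x, s k)) \<longlonglongrightarrow> G (x, y)"
        using s x y by (intro continuous_on_tendsto_compose[OF G] tendsto_intros) auto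
    qed
  qed
  then show ?thesis
    by (auto simp: continuous_on_sequentially o_def)
qed

text \<open>
  The product of the two Lebesgue \<open>\<sigma>\<close>-algebras is coarser than the Lebesgue \<open>\<sigma>\<close>-algebra of the
  product space, but it contains the traces of the Borel sets, because the Borel \<open>\<sigma>\<close>-algebra of the
  product space is generated by rectangles.
\<close>

lemma continuous_on_measurable_lebesgue_on_pair:
  fixes G :: "'a::euclidean_space \<times> 'b::euclidean_space \<Rightarrow> real"
  assumes G: "continuous_on (X \<times> Y) G"
  shows "G \<in> borel_measurable (lebesgue_on X \<Otimes>\<^sub>M lebesgue_on Y)"
proof -
  have id: "(\<lambda>x. x) \<in> measurable (lebesgue_on D) borel" for D :: "'c::euclidean_space set"
    by (intro measurable_restrict_space1) (simp add: measurable_completion)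
  have "(\<lambda>p. (fst p, snd p)) \<in> measurable (lebesgue_on X \<Otimes>\<^sub>M lebesgue_on Y) (borel \<Otimes>\<^sub>M borel)"
    by (intro measurable_Pair measurable_compose[OF measurable_fst id]
        measurable_compose[OF measurable_snd id])
  then have "(\<lambda>p. p) \<in> measurable (lebesgue_on X \<Otimes>\<^sub>M lebesgue_on Y) (restrict_space borel (X \<times> Y))"
    by (intro measurable_restrict_space2) (auto simp: space_pair_measure borel_prod)
  from measurable_compose[OF this borel_measurable_continuous_on_restrict[OF G]]
  show ?thesis by simp
qed

text \<open>The integrand is dominated by a multiple of the integrable tensor product \<open>F x * c y\<close>.\<close>

lemma integral_operator_Fubini:
  fixes G :: "'a::euclidean_space \<times> 'b::euclidean_space \<Rightarrow> real"
  assumes X: "compact X" and Y: "compact Y" and G: "continuous_on (X \<times> Y) G"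
    and F: "F \<in> L2 X" and c: "c \<in> L2 Y"
  shows "(LINT y|lebesgue_on Y. c y * (LINT x|lebesgue_on X. G (x, y) * F x)) =
         (LINT x|lebesgue_on X. LINT y|lebesgue_on Y. G (x, y) * F x * c y)"
proof -
  interpret X: finite_measure "lebesgue_on X"
    using X by (intro finite_measure_lebesgue_on lmeasurable_compact)
  interpret Y: finite_measure "lebesgue_on Y"
    using Y by (intro finite_measure_lebesgue_on lmeasurable_compact)
  interpret pair_sigma_finite "lebesgue_on X" "lebesgue_on Y" ..
  obtain B where B: "\<And>p. p \<in> X \<times> Y \<Longrightarrow> \<bar>G p\<bar> \<le> B"
    using continuous_on_compact_bounded_by[OF compact_Times[OF X Y] G] by blast
  have [measurable]: "F \<in> borel_measurable (lebesgue_on X)" "c \<in> borel_measurable (lebesgue_on Y)"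
      "G \<in> borel_measurable (lebesgue_on X \<Otimes>\<^sub>M lebesgue_on Y)"
    using F c G by (auto intro: L2_measurable continuous_on_measurable_lebesgue_on_pair)
  have "integrable (lebesgue_on X \<Otimes>\<^sub>M lebesgue_on Y) (\<lambda>(x, y). F x * c y)"
    using L2_integrable[OF X F] L2_integrable[OF Y c]
    by (intro Fubini_integrable) (simp_all add: abs_mult)
  then have "integrable (lebesgue_on X \<Otimes>\<^sub>M lebesgue_on Y) (\<lambda>p. B * \<bar>F (fst p) * c (snd p)\<bar>)"
    by (intro integrable_mult_right integrable_abs) (simp add: case_prod_unfold)
  then have "integrable (lebesgue_on X \<Otimes>\<^sub>M lebesgue_on Y) (\<lambda>p. G p * F (fst p) * c (snd p))"
  proof (rule Bochner_Integration.integrable_bound)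
    show "AE p in lebesgue_on X \<Otimes>\<^sub>M lebesgue_on Y.
        norm (G p * F (fst p) * c (snd p)) \<le> norm (B * \<bar>F (fst p) * c (snd p)\<bar>)"
    proof (intro AE_I2)
      fix p assume "p \<in> space (lebesgue_on X \<Otimes>\<^sub>M lebesgue_on Y)"
      then have "\<bar>G p\<bar> \<le> \<bar>B\<bar>"
        using B[of p] by (force simp: space_pair_measure)
      then show "norm (G p * F (fst p) * c (snd p)) \<le> norm (B * \<bar>F (fst p) * c (snd p)\<bar>)"
        by (simp add: abs_mult mult.assoc mult_right_mono)
    qed
  qed measurable
  then have "integrable (lebesgue_on X \<Otimes>\<^sub>M lebesgue_on Y) (\<lambda>(x, y). G (x, y) * F x * c y)"
    by (simp add: case_prod_unfold)
  from Fubini_integral[OF this]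
  show ?thesis
    by (simp add: mult.commute[of "c _"])
qed

section \<open>Function Hilbert spaces and reproducing kernels\<close>

context function_hilbert_space
begin

lemma ip_norm_square: "f \<in> H \<Longrightarrow> (ip_norm ip f)\<^sup>2 = ip f f"
  by (simp add: ip_norm_def ip_nonneg)

lemma ip_add_scale_right:
  assumes "f \<in> H" "g \<in> H" "h \<in> H"
  shows "ip h (\<lambda>z. f z + t * g z) = ip h f + t * ip h g"
  using assms by (simp add: ip_commute[of h] add_mem scale_mem ip_add ip_scale)

lemma ip_norm_square_add_scale:
  assumes "f \<in> H" "g \<in> H"
  shows "(ip_norm ip (\<lambda>z. f z + t * g z))\<^sup>2 =
    (ip_norm ip f)\<^sup>2 + 2 * t * ip f g + t\<^sup>2 * (ip_norm ip g)\<^sup>2"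
proof -
  have "ip (\<lambda>z. f z + t * g z) (\<lambda>z. f z + t * g z) =
      (ip f f + t * ip g f) + t * (ip f g + t * ip g g)"
    using assms by (simp add: ip_add_scale_right add_mem scale_mem ip_add ip_scale)
  then show ?thesis
    unfolding ip_norm_square[OF add_mem[OF assms(1) scale_mem[OF assms(2)]]]
      ip_norm_square[OF assms(1)] ip_norm_square[OF assms(2)]
    using ip_commute[OF assms] by (simp add: algebra_simps power2_eq_square)
qed

lemma Cauchy_Schwarz:
  assumes f: "f \<in> H" and g: "g \<in> H"
  shows "\<bar>ip f g\<bar> \<le> ip_norm ip f * ip_norm ip g"
proof (cases "ip g g = 0")
  case True
  have "g = (\<lambda>z. 0 * g z)"
    using ip_definite[OF g True] by simp
  then have "ip g f = 0"
    using ip_scale[OF g f, of 0] by simp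
  then show ?thesis
    using f g ip_nonneg[OF f] True by (simp add: ip_commute[OF f g] ip_norm_def)
next
  case False
  then have pos: "0 < ip g g"
    using ip_nonneg[OF g] by simp
  \<comment> \<open>The minimizer of the norm of \<open>f + t g\<close>.\<close>
  define t where "t = - (ip f g / ip g g)"
  have "0 \<le> (ip_norm ip f)\<^sup>2 + 2 * t * ip f g + t\<^sup>2 * (ip_norm ip g)\<^sup>2"
    unfolding ip_norm_square_add_scale[OF f g, symmetric] by simp
  also have "\<dots> = ip f f - (ip f g)\<^sup>2 / ip g g"
    unfolding ip_norm_square[OF f] ip_norm_square[OF g] t_def
    using pos by (simp add: field_simps power2_eq_square)
  finally have "(ip f g)\<^sup>2 \<le> ip f f * ip g g"
    using pos by (simp add: field_simps)
  then have "sqrt ((ip f g)\<^sup>2) \<le> sqrt (ip f f * ip g g)"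
    by (rule real_sqrt_le_mono)
  then show ?thesis
    by (simp add: ip_norm_def real_sqrt_mult)
qed

end

lemma (in rkhs) ip_kernel_sections:
  assumes "w \<in> D" "z \<in> D"
  shows "ip (kernel_section D K w) (kernel_section D K z) = K w z"
proof -
  have "K w z = kernel_section D K w z"
    using assms by (simp add: kernel_section_def)
  also have "\<dots> = ip (kernel_section D K w) (kernel_section D K z)"
    using assms by (intro reproducing section_mem)
  finally show ?thesis ..
qed

text \<open>
  By the reproducing property and Cauchy--Schwarz, \<open>\<bar>f w - f z\<bar>\<close> is at most the norm of \<open>f\<close> times
  the distance of the kernel sections at \<open>w\<close> and \<open>z\<close>. That distance, \<open>d w\<close> in the proof, is
  expressed by values of the kernel and therefore tends to \<open>0\<close> as \<open>w\<close> tends to \<open>z\<close>.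
\<close>

lemma rkhs_member_continuous_on:
  fixes D :: "'z::topological_space set"
  assumes rkhs: "rkhs D H ip K" and K: "continuous_kernel D K" and f: "f \<in> H"
  shows "continuous_on D f"
  unfolding continuous_on_def
proof
  interpret rkhs D H ip K by (fact rkhs)
  fix z assume z: "z \<in> D"
  define d where "d = (\<lambda>w. sqrt (K w w - K w z - K z w + K z z))"
  have bound: "\<bar>f w - f z\<bar> \<le> ip_norm ip f * d w" if w: "w \<in> D" for w
  proof -
    let ?kw = "kernel_section D K w" and ?kz = "kernel_section D K z"
    let ?k = "\<lambda>v. ?kw v + (- 1) * ?kz v"
    have mem: "?kw \<in> H" "?kz \<in> H"
      using w z by (simp_all add: section_mem)
    have k: "?k \<in> H"
      by (intro add_mem scale_mem mem)
    have "f w - f z = ip f ?k"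
      unfolding ip_add_scale_right[OF mem f] using reproducing[OF f] w z by simp
    moreover have "ip ?k ?k = K w w - K w z - K z w + K z z"
      using ip_norm_square_add_scale[OF mem, of "- 1"] ip_commute[OF mem] w z
      unfolding ip_norm_square[OF k] ip_norm_square[OF mem(1)] ip_norm_square[OF mem(2)]
      by (simp add: ip_kernel_sections)
    then have "ip_norm ip ?k = d w"
      by (simp only: ip_norm_def d_def)
    ultimately show ?thesis
      using Cauchy_Schwarz[OF f k] by simp
  qed
  have Kc: "((\<lambda>w. K (p w) (q w)) \<longlongrightarrow> K z z) (at z within D)"
    if "(p \<longlongrightarrow> z) (at z within D)" "(q \<longlongrightarrow> z) (at z within D)"
      "\<And>w. w \<in> D \<Longrightarrow> p w \<in> D" "\<And>w. w \<in> D \<Longrightarrow> q w \<in> D" for p q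
    using continuous_on_tendsto_compose[OF K[unfolded continuous_kernel_def],
        of "\<lambda>w. (p w, q w)" "(z, z)"] that z
    by (auto simp: tendsto_Pair eventually_at_filter)
  have "((\<lambda>w. ip_norm ip f * d w) \<longlongrightarrow> ip_norm ip f * sqrt (K z z - K z z - K z z + K z z))
      (at z within D)"
    unfolding d_def using z by (intro tendsto_intros Kc) auto
  then have "((\<lambda>w. ip_norm ip f * d w) \<longlongrightarrow> 0) (at z within D)"
    by simp
  moreover have "\<forall>\<^sub>F w in at z within D. norm (f w - f z) \<le> ip_norm ip f * d w"
    using bound by (simp add: eventually_at_filter)
  ultimately have "((\<lambda>w. f w - f z) \<longlongrightarrow> 0) (at z within D)"
    by (rule Lim_null_comparison[rotated])
  then show "(f \<longlongrightarrow> f z) (at z within D)"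
    by (rule LIM_zero_cancel)
qed

section \<open>The representer theorem\<close>

text \<open>
  This is how minimality enters: near \<open>0\<close> the linear term dominates, so it must be absent from
  a quadratic polynomial that vanishes at \<open>0\<close> and is nonnegative everywhere.
\<close>

lemma linear_coefficient_zero_if_nonneg:
  fixes a b :: real
  assumes "\<And>t. 0 \<le> t * a + t\<^sup>2 * b"
  shows "a = 0"
proof (rule ccontr)
  assume "a \<noteq> 0"
  \<comment> \<open>A step against the sign of \<open>a\<close>, so short that the quadratic term cannot compensate.\<close>
  define s where "s = 1 / (\<bar>b\<bar> + 1)"
  have s: "0 < s" "s * b < 1"
    by (auto simp: s_def field_simps)
  have "0 \<le> (- s * a) * a + (- s * a)\<^sup>2 * b"
    by (rule assms)
  also have "\<dots> = - (s * a\<^sup>2 * (1 - s * b))"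
    by (simp add: power2_eq_square algebra_simps)
  also have "\<dots> < 0"
    using s \<open>a \<noteq> 0\<close> by simp
  finally show False by simp
qed

theorem theorem4:
  fixes DX :: "'a::euclidean_space set" and DY :: "'b::euclidean_space set"
    and HG :: "('a \<times> 'b \<Rightarrow> real) set"
    and ipG :: "('a \<times> 'b \<Rightarrow> real) \<Rightarrow> ('a \<times> 'b \<Rightarrow> real) \<Rightarrow> real"
    and K :: "'a \<times> 'b \<Rightarrow> 'a \<times> 'b \<Rightarrow> real"
    and HB :: "('b \<Rightarrow> real) set"
    and ipB :: "('b \<Rightarrow> real) \<Rightarrow> ('b \<Rightarrow> real) \<Rightarrow> real"
    and Q :: "'b \<Rightarrow> 'b \<Rightarrow> real"
    and n :: nat and F :: "nat \<Rightarrow> 'a \<Rightarrow> real" and U :: "nat \<Rightarrow> 'b \<Rightarrow> real"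
    and \<rho> \<mu> :: real
    and \<beta>hat :: "'b \<Rightarrow> real" and Ghat :: "'a \<times> 'b \<Rightarrow> real"
  assumes "compact DX" and "compact DY"
    and "rkhs (DX \<times> DY) HG ipG K" and "rkhs DY HB ipB Q"
    and "continuous_kernel (DX \<times> DY) K" and "continuous_kernel DY Q"
    and "square_integrable_kernel (DX \<times> DY) K" and "square_integrable_kernel DY Q"
    and "symmetric_kernel (DX \<times> DY) K" and "symmetric_kernel DY Q"
    and "strictly_positive_definite_kernel (DX \<times> DY) K"
    and "strictly_positive_definite_kernel DY Q"
    and "n \<ge> 1"
    and "\<And>i. i \<in> {1..n} \<Longrightarrow> F i \<in> L2 DX" and "\<And>i. i \<in> {1..n} \<Longrightarrow> U i \<in> L2 DY"
    and "\<rho> > 0" and "\<mu> > 0"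
    and "is_arg_min (\<lambda>(\<beta>, G). reg_emp_risk DX DY ipB ipG n F U \<rho> \<mu> \<beta> G)
           (\<lambda>p. p \<in> HB \<times> HG) (\<beta>hat, Ghat)"
  shows "\<exists>c. (\<forall>i\<in>{1..n}. c i \<in> L2 DY) \<and>
    (\<forall>x\<in>DX. \<forall>y\<in>DY. Ghat (x, y) =
       (\<Sum>i=1..n. LINT \<xi>|lebesgue_on DX. LINT \<eta>|lebesgue_on DY.
          K (x, y) (\<xi>, \<eta>) * F i \<xi> * c i \<eta>))"
proof -
  interpret G: rkhs "DX \<times> DY" HG ipG K by fact
  note DX = \<open>compact DX\<close> and DY = \<open>compact DY\<close>
  note F = \<open>\<And>i. i \<in> {1..n} \<Longrightarrow> F i \<in> L2 DX\<close>
  have mem: "\<beta>hat \<in> HB" "Ghat \<in> HG"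
    and opt: "\<And>G. G \<in> HG \<Longrightarrow> reg_emp_risk DX DY ipB ipG n F U \<rho> \<mu> \<beta>hat Ghat
      \<le> reg_emp_risk DX DY ipB ipG n F U \<rho> \<mu> \<beta>hat G"
    using assms(18) by (auto simp: is_arg_min_def not_less)
  have cont: "continuous_on (DX \<times> DY) G" if "G \<in> HG" for G
    using that assms(3,5) by (intro rkhs_member_continuous_on)
  define T where "T i G = (\<lambda>y. LINT x|lebesgue_on DX. G (x, y) * F i x)"
    for i and G :: "'a \<times> 'b \<Rightarrow> real"
  have T_L2: "T i G \<in> L2 DY" if "i \<in> {1..n}" "G \<in> HG" for i G
    unfolding T_def
    by (rule continuous_on_compact_L2[OF DY
          continuous_on_integral_operator[OF DX DY cont[OF that(2)] F[OF that(1)]]])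
  define r where "r i = (\<lambda>y. U i y - \<beta>hat y - T i Ghat y)" for i
  have r_L2: "r i \<in> L2 DY" if "i \<in> {1..n}" for i
    unfolding r_def using assms(15) that mem DY rkhs_member_continuous_on[OF assms(4,6)]
    by (intro L2_diff T_L2 continuous_on_compact_L2[of DY \<beta>hat])

  have stationary: "\<mu> * ipG Ghat G = 1 / real n * (\<Sum>i=1..n. LINT y|lebesgue_on DY. r i y * T i G y)"
    if G: "G \<in> HG" for G
  proof -
    let ?R = "reg_emp_risk DX DY ipB ipG n F U \<rho> \<mu> \<beta>hat"
    let ?S = "\<Sum>i=1..n. LINT y|lebesgue_on DY. r i y * T i G y"
    let ?N = "\<Sum>i=1..n. (L2_norm DY (T i G))\<^sup>2"
    have R_eq: "?R G' = 1 / real n * (\<Sum>i=1..n. (L2_norm DY (\<lambda>y. U i y - \<beta>hat y - T i G' y))\<^sup>2)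
        + \<rho> * (ip_norm ipB \<beta>hat)\<^sup>2 + \<mu> * (ip_norm ipG G')\<^sup>2" for G'
      by (simp add: reg_emp_risk_def T_def)
    have fit: "(L2_norm DY (\<lambda>y. U i y - \<beta>hat y - T i (\<lambda>p. Ghat p + t * G p) y))\<^sup>2 =
        (L2_norm DY (r i))\<^sup>2 - 2 * t * (LINT y|lebesgue_on DY. r i y * T i G y)
          + t\<^sup>2 * (L2_norm DY (T i G))\<^sup>2" if i: "i \<in> {1..n}" for i t
    proof -
      have "T i (\<lambda>p. Ghat p + t * G p) y = T i Ghat y + t * T i G y" if "y \<in> DY" for y
        using integrable_continuous_section_mult[OF DX cont F[OF i] that] mem(2) G
        by (simp add: T_def distrib_right mult.assoc)
      then have "(L2_norm DY (\<lambda>y. U i y - \<beta>hat y - T i (\<lambda>p. Ghat p + t * G p) y))\<^sup>2 =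
          (L2_norm DY (\<lambda>y. r i y - t * T i G y))\<^sup>2"
        unfolding L2_norm_square
        by (intro Bochner_Integration.integral_cong) (simp_all add: r_def algebra_simps)
      then show ?thesis
        unfolding L2_norm_square_diff_scale[OF r_L2[OF i] T_L2[OF i G]] .
    qed
    have risk: "?R (\<lambda>p. Ghat p + t * G p) =
        ?R Ghat + (t * (2 * (\<mu> * ipG Ghat G - 1 / real n * ?S))
          + t\<^sup>2 * (1 / real n * ?N + \<mu> * (ip_norm ipG G)\<^sup>2))" for t
    proof -
      have sums: "(\<Sum>i=1..n. (L2_norm DY (\<lambda>y. U i y - \<beta>hat y - T i (\<lambda>p. Ghat p + t * G p) y))\<^sup>2) =
          (\<Sum>i=1..n. (L2_norm DY (r i))\<^sup>2) - 2 * t * ?S + t\<^sup>2 * ?N"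
        using fit by (simp add: sum.distrib sum_subtractf sum_distrib_left)
      show ?thesis
        unfolding R_eq sums G.ip_norm_square_add_scale[OF mem(2) G] r_def[symmetric]
        by (simp add: algebra_simps add_divide_distrib diff_divide_distrib)
    qed
    have "0 \<le> t * (2 * (\<mu> * ipG Ghat G - 1 / real n * ?S))
          + t\<^sup>2 * (1 / real n * ?N + \<mu> * (ip_norm ipG G)\<^sup>2)" for t
      using opt[of "\<lambda>p. Ghat p + t * G p"] risk[of t] G mem(2)
      by (simp add: G.add_mem G.scale_mem)
    from linear_coefficient_zero_if_nonneg[OF this] show ?thesis
      by simp
  qed

  define c where "c i = (\<lambda>y. 1 / (\<mu> * real n) * r i y)" for i
  have c_L2: "c i \<in> L2 DY" if "i \<in> {1..n}" for i
    unfolding c_def using r_L2[OF that] by (rule L2_scale)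
  have "Ghat (x, y) = (\<Sum>i=1..n. LINT \<xi>|lebesgue_on DX. LINT \<eta>|lebesgue_on DY.
          K (x, y) (\<xi>, \<eta>) * F i \<xi> * c i \<eta>)" if xy: "x \<in> DX" "y \<in> DY" for x y
  proof -
    let ?k = "kernel_section (DX \<times> DY) K (x, y)"
    have k: "?k \<in> HG"
      using xy by (intro G.section_mem) simp
    have "\<mu> * Ghat (x, y) = \<mu> * ipG Ghat ?k"
      using G.reproducing[OF mem(2)] xy by simp
    then have "Ghat (x, y) = 1 / (\<mu> * real n) * (\<Sum>i=1..n. LINT \<eta>|lebesgue_on DY. r i \<eta> * T i ?k \<eta>)"
      using \<open>\<mu> > 0\<close> \<open>n \<ge> 1\<close> unfolding stationary[OF k] by (simp add: field_simps)
    also have "\<dots> = (\<Sum>i=1..n. LINT \<eta>|lebesgue_on DY. c i \<eta> * T i ?k \<eta>)"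
      by (simp add: c_def sum_divide_distrib)
    also have "\<dots> = (\<Sum>i=1..n. LINT \<xi>|lebesgue_on DX. LINT \<eta>|lebesgue_on DY. ?k (\<xi>, \<eta>) * F i \<xi> * c i \<eta>)"
      unfolding T_def using c_L2 F DX DY cont[OF k]
      by (intro sum.cong refl integral_operator_Fubini)
    also have "\<dots> = (\<Sum>i=1..n. LINT \<xi>|lebesgue_on DX. LINT \<eta>|lebesgue_on DY. K (x, y) (\<xi>, \<eta>) * F i \<xi> * c i \<eta>)"
      by (intro sum.cong refl Bochner_Integration.integral_cong) (auto simp: kernel_section_def)
    finally show ?thesis .
  qed
  with c_L2 show ?thesis by blast
qed

end
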